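(* Let $X$ be a non-negative absolutely continuous random variable with mean $\mu$ and (finite) variance $\sigma^2$, $\sigma>0$, whose distribution is symmetric about $\mu$. Then the sum of the cumulative residual entropy and the cumulative entropy of $X$ satisfies $$\mathcal{E}(X)+\mathcal{CE}(X)\leq \sqrt{2}\,\sigma\sum_{n=1}^{+\infty}\frac{1}{n}\sqrt{\frac{1}{2n+1}-B(n+1,n+1)},$$ where $B(\cdot,\cdot)$ is the complete beta function.
   Context: $\log$ is the natural logarithm, with the convention $0\log 0=0$. For a non-negative absolutely continuous random variable $X$ with cumulative distribution function $F$, the cumulative residual entropy is $\mathcal{E}(X)=-\int_0^{+\infty}(1-F(x))\log(1-F(x))\,dx$ and the cumulative entropy is $\mathcal{CE}(X)=-\int_0^{+\infty}F(x)\log F(x)\,dx$. The distribution of $X$ is symmetric about $\mu$ if $X-\mu$ and $\mu-X$ have the same distribution. The complete beta function is $B(a,b)=\int_0^1 t^{a-1}(1-t)^{b-1}\,dt$. *)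

theory Defs
  imports "HOL-Probability.Probability"
begin

text \<open>
  The logarithm is the real natural logarithm \<^const>\<open>ln\<close>.  The products below vanish where the factor
  in front of \<^const>\<open>ln\<close> is zero, so the convention \<open>0 log 0 = 0\<close> holds automatically.
  Lebesgue integrals are total in HOL: an integral is \<open>0\<close> when its integrand is not integrable.  Hence
  each entropy comes with a predicate stating that its integral is finite.
\<close>

definition cumulative_residual_entropy :: "'a measure \<Rightarrow> ('a \<Rightarrow> real) \<Rightarrow> real" where
  "cumulative_residual_entropy M X =
     - (LBINT x:{0..}. (1 - cdf (distr M borel X) x) * ln (1 - cdf (distr M borel X) x))"

definition finite_cumulative_residual_entropy :: "'a measure \<Rightarrow> ('a \<Rightarrow> real) \<Rightarrow> bool" where
  "finite_cumulative_residual_entropy M X \<longleftrightarrow>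
     set_integrable lborel {0..}
       (\<lambda>x. (1 - cdf (distr M borel X) x) * ln (1 - cdf (distr M borel X) x))"

definition cumulative_entropy :: "'a measure \<Rightarrow> ('a \<Rightarrow> real) \<Rightarrow> real" where
  "cumulative_entropy M X =
     - (LBINT x:{0..}. cdf (distr M borel X) x * ln (cdf (distr M borel X) x))"

definition finite_cumulative_entropy :: "'a measure \<Rightarrow> ('a \<Rightarrow> real) \<Rightarrow> bool" where
  "finite_cumulative_entropy M X \<longleftrightarrow>
     set_integrable lborel {0..}
       (\<lambda>x. cdf (distr M borel X) x * ln (cdf (distr M borel X) x))"

definition symmetric_about :: "'a measure \<Rightarrow> ('a \<Rightarrow> real) \<Rightarrow> real \<Rightarrow> bool" where
  "symmetric_about M X m \<longleftrightarrow>
     distr M borel (\<lambda>\<omega>. X \<omega> - m) = distr M borel (\<lambda>\<omega>. m - X \<omega>)"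

text \<open>
  \<^const>\<open>Beta\<close> is defined through the Gamma function in the library; for positive real arguments it is
  the complete beta integral by \<open>has_integral_Beta_real\<close>.
\<close>

definition entropy_bound_term :: "nat \<Rightarrow> real" where
  "entropy_bound_term n =
     1 / real n * sqrt (1 / (2 * real n + 1) - Beta (real n + 1) (real n + 1))"

end

theory Submission
  imports Defs
begin

text \<open>
  Write \<open>F\<close> for the distribution function of \<open>X\<close> and \<open>Q\<close> for its quantile function on \<open>(0, 1)\<close>.
  The two entropies add up to the integral of \<open>H (F x)\<close> over \<open>x \<ge> 0\<close>, where
  \<open>H p = - p ln p - (1 - p) ln (1 - p)\<close>.  With the antisymmetric weights
  \<open>w\<^sub>n u = u ^ n - (1 - u) ^ n\<close>, the logarithmic series give \<open>ln u - ln (1 - u) = \<Sum>\<^sub>n w\<^sub>n u / n\<close>,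
  hence, after integration from \<open>p\<close> to \<open>1\<close>, the expansion \<open>H p = \<Sum>\<^sub>n k\<^sub>n p / n\<close> into the
  non-negative functions \<open>k\<^sub>n p = \<integral>\<^sub>p\<^sup>1 w\<^sub>n\<close> (\<open>entropy_power_gap_sums\<close>).

  Each term is controlled separately.  Since \<open>F x < u\<close> means the same as \<open>x < Q u\<close>, Fubini's theorem
  turns the integral of \<open>k\<^sub>n (F x)\<close> over \<open>x \<ge> 0\<close> into the integral of \<open>w\<^sub>n Q\<close> over \<open>(0, 1)\<close>
  (\<open>weighted_layer_cake\<close>).  As \<open>w\<^sub>n\<close> has integral zero, \<open>Q\<close> may be replaced by \<open>Q - \<mu>\<close>, whose
  \<open>L\<^sup>2\<close> norm is \<open>\<sigma>\<close>.  The Cauchy-Schwarz inequality then bounds the integral by \<open>\<sigma>\<close> times the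
  norm of \<open>w\<^sub>n\<close>, whose square is \<open>2 (1 / (2 n + 1) - B (n + 1, n + 1))\<close>
  (\<open>power_gap_square_integral\<close>); this is \<open>power_gap_tail_cdf_integral\<close>.  The bounds divided by \<open>n\<close>
  are of order \<open>n powr (- 3 / 2)\<close>, so they can be summed, and the same summability allows the series
  for \<open>H\<close> to be integrated term by term.  Finiteness of each entropy follows, because both integrands
  have the same sign and are dominated by \<open>H (F x)\<close>.
\<close>

section \<open>Power gaps on the unit interval\<close>

abbreviation unit_uniform :: "real measure" where
  "unit_uniform \<equiv> restrict_space lborel {0<..<1::real}"

definition power_gap :: "nat \<Rightarrow> real \<Rightarrow> real" where
  "power_gap n u = u ^ n - (1 - u) ^ n"

text \<open>
  The closed form of the integral of \<^const>\<open>power_gap\<close> over \<open>{p..1}\<close>.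
\<close>

definition power_gap_tail :: "nat \<Rightarrow> real \<Rightarrow> real" where
  "power_gap_tail n p = (1 - p ^ Suc n - (1 - p) ^ Suc n) / real (Suc n)"

lemma prob_space_unit_uniform: "prob_space unit_uniform"
  by (auto simp: space_restrict_space emeasure_restrict_space intro!: prob_spaceI)

text \<open>
  The quantile representation lives on the open interval, since quantiles may be infinite at its ends;
  explicit integrals come from the gauge integral on the closed one.  This lemma transfers them.
\<close>

lemma unit_uniform_integral:
  fixes f :: "real \<Rightarrow> real"
  assumes "continuous_on {0..1} f" and "(f has_integral I) {0..1}"
  shows "integrable unit_uniform f" and "integral\<^sup>L unit_uniform f = I"
proof -
  have Icc: "set_integrable lborel {0..1} f"
    by (rule borel_integrable_atLeastAtMost'[OF assms(1)])
  then have Ioo: "set_integrable lborel {0<..<1} f"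
    by (rule set_integrable_subset) auto
  then show "integrable unit_uniform f"
    by (simp add: integrable_restrict_space set_integrable_def)
  have "(f has_integral (LBINT x:{0<..<1}. f x)) {0<..<1}"
    using set_borel_integral_eq_integral[OF Ioo] by (metis integrable_integral)
  then have "(LBINT x:{0<..<1}. f x) = I"
    using assms(2) by (metis has_integral_Icc_iff_Ioo has_integral_unique)
  then show "integral\<^sup>L unit_uniform f = I"
    by (simp add: integral_restrict_space set_lebesgue_integral_def)
qed

lemma power_primitive:
  fixes u :: real
  shows "((\<lambda>u. u ^ Suc n / real (Suc n)) has_real_derivative u ^ n) (at u within S)"
    and "((\<lambda>u. - ((1 - u) ^ Suc n / real (Suc n))) has_real_derivative (1 - u) ^ n) (at u within S)"
proof -
  have prim: "((\<lambda>u. u ^ Suc n / real (Suc n)) has_real_derivative u ^ n) (at u within S)" for u :: real and S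
    using DERIV_cdivide[OF DERIV_pow[of "Suc n" u S], of "real (Suc n)"] by (simp del: of_nat_Suc)
  then show "((\<lambda>u. u ^ Suc n / real (Suc n)) has_real_derivative u ^ n) (at u within S)" .
  have "((\<lambda>u. 1 - u) has_real_derivative - 1) (at u within S)"
    by (auto intro!: derivative_eq_intros)
  from DERIV_minus[OF DERIV_chain2[OF prim this]]
  show "((\<lambda>u. - ((1 - u) ^ Suc n / real (Suc n))) has_real_derivative (1 - u) ^ n) (at u within S)"
    by simp
qed

lemma power_gap_integral_above:
  assumes "0 \<le> p" "p \<le> 1"
  shows "(\<integral>u. power_gap n u * indicator {p<..} u \<partial>unit_uniform) = power_gap_tail n p"
proof -
  define G where "G u = u ^ Suc n / real (Suc n) - - ((1 - u) ^ Suc n / real (Suc n))" for u :: real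
  have "(\<integral>u. power_gap n u * indicator {p<..} u \<partial>unit_uniform)
      = (\<integral>u. power_gap n u * indicator {p..1} u \<partial>lborel)"
  proof (simp add: integral_restrict_space, rule integral_cong_AE)
    show "AE u in lborel. indicator {0<..<1} u * (power_gap n u * indicator {p<..} u)
        = power_gap n u * indicator {p..1} u"
      \<comment> \<open>The integrands may differ at the end points, that is, at \<open>p\<close> and at \<open>1\<close>.\<close>
      using AE_lborel_singleton[of p] AE_lborel_singleton[of 1]
      by eventually_elim (use assms in \<open>auto simp: indicator_def\<close>)
  qed (auto simp: power_gap_def)
  also have "\<dots> = G 1 - G p"
  proof (rule integral_FTC_Icc_real[OF \<open>p \<le> 1\<close>])
    show "(G has_real_derivative power_gap n u) (at u)" for u
      unfolding G_def[abs_def] power_gap_def by (intro DERIV_diff power_primitive)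
  qed (auto simp: power_gap_def)
  also have "\<dots> = power_gap_tail n p"
    by (simp add: G_def power_gap_tail_def diff_divide_distrib add_divide_distrib)
  finally show ?thesis .
qed

text \<open>
  Here the radicand of \<^const>\<open>entropy_bound_term\<close> arises: expanding the square leaves two equal
  power integrals and a mixed term that is the beta integral.
\<close>

lemma power_gap_square_integral:
  shows "integrable unit_uniform (\<lambda>u. (power_gap n u)\<^sup>2)"
    and "(\<integral>u. (power_gap n u)\<^sup>2 \<partial>unit_uniform)
           = 2 * (1 / (2 * real n + 1) - Beta (real n + 1) (real n + 1))"
proof -
  have pow: "((\<lambda>u. u ^ (2 * n)) has_integral 1 / (2 * real n + 1)) {0..1::real}"
    and pow': "((\<lambda>u. (1 - u) ^ (2 * n)) has_integral 1 / (2 * real n + 1)) {0..1::real}"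
  proof -
    have "((\<lambda>u. u ^ (2 * n)) has_integral
        (1 ^ Suc (2 * n) / real (Suc (2 * n)) - 0 ^ Suc (2 * n) / real (Suc (2 * n)))) {0..1::real}"
      by (rule fundamental_theorem_of_calculus)
        (simp_all only: power_primitive zero_le_one flip: has_real_derivative_iff_has_vector_derivative)
    then show "((\<lambda>u. u ^ (2 * n)) has_integral 1 / (2 * real n + 1)) {0..1::real}"
      by (simp add: add.commute)
    have "((\<lambda>u. (1 - u) ^ (2 * n)) has_integral
        (- ((1 - 1) ^ Suc (2 * n) / real (Suc (2 * n))) - - ((1 - 0) ^ Suc (2 * n) / real (Suc (2 * n))))) {0..1::real}"
      by (rule fundamental_theorem_of_calculus)
        (simp_all only: power_primitive zero_le_one flip: has_real_derivative_iff_has_vector_derivative)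
    then show "((\<lambda>u. (1 - u) ^ (2 * n)) has_integral 1 / (2 * real n + 1)) {0..1::real}"
      by (simp add: add.commute)
  qed
  have "((\<lambda>u. u powr (real n + 1 - 1) * (1 - u) powr (real n + 1 - 1))
      has_integral Beta (real n + 1) (real n + 1)) {0<..<1}"
    using has_integral_Beta_real[of "real n + 1" "real n + 1"] by (simp add: has_integral_Icc_iff_Ioo)
  then have "((\<lambda>u. u ^ n * (1 - u) ^ n) has_integral Beta (real n + 1) (real n + 1)) {0<..<1::real}"
    by (rule has_integral_eq[rotated]) (simp add: powr_realpow)
  then have cross: "((\<lambda>u. u ^ n * (1 - u) ^ n) has_integral Beta (real n + 1) (real n + 1)) {0..1::real}"
    by (simp add: has_integral_Icc_iff_Ioo)
  have "((\<lambda>u. u ^ (2 * n) + (1 - u) ^ (2 * n) - 2 * (u ^ n * (1 - u) ^ n)) has_integral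
      (1 / (2 * real n + 1) + 1 / (2 * real n + 1) - 2 * Beta (real n + 1) (real n + 1))) {0..1}"
    by (intro has_integral_diff has_integral_add has_integral_mult_right pow pow' cross)
  moreover have "u ^ (2 * n) + (1 - u) ^ (2 * n) - 2 * (u ^ n * (1 - u) ^ n) = (power_gap n u)\<^sup>2" for u :: real
    by (simp add: power_gap_def power2_diff mult.assoc flip: power_mult) (simp add: mult.commute)
  ultimately have "((\<lambda>u. (power_gap n u)\<^sup>2) has_integral
      2 * (1 / (2 * real n + 1) - Beta (real n + 1) (real n + 1))) {0..1}"
    by (simp add: right_diff_distrib)
  moreover have "continuous_on {0..1} (\<lambda>u. (power_gap n u)\<^sup>2)"
    by (auto simp: power_gap_def intro!: continuous_intros)
  ultimately show "integrable unit_uniform (\<lambda>u. (power_gap n u)\<^sup>2)"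
    and "(\<integral>u. (power_gap n u)\<^sup>2 \<partial>unit_uniform)
           = 2 * (1 / (2 * real n + 1) - Beta (real n + 1) (real n + 1))"
    using unit_uniform_integral by blast+
qed

lemma power_gap_tail_nonneg:
  assumes "0 \<le> p" "p \<le> 1"
  shows "0 \<le> power_gap_tail n p"
proof -
  have "p ^ Suc n \<le> p" "(1 - p) ^ Suc n \<le> 1 - p"
    using assms power_le_one[of p n] power_le_one[of "1 - p" n]
    by (auto intro!: mult_left_le)
  then show ?thesis
    unfolding power_gap_tail_def by (intro divide_nonneg_nonneg) auto
qed

section \<open>Expansion of the entropy function\<close>

text \<open>
  Splitting \<open>1 / (m (m + 1))\<close> into \<open>1 / m - 1 / (m + 1)\<close> reduces the series to two shifts of the
  series of \<open>- ln (1 - x)\<close>.  That series diverges at \<open>x = 1\<close>, where the splitting telescopes instead.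
\<close>

lemma ln_power_sums:
  fixes x :: real
  assumes "0 \<le> x" "x \<le> 1"
  shows "(\<lambda>n. x ^ Suc (Suc n) / (real (Suc n) * real (Suc (Suc n)))) sums (x + (1 - x) * ln (1 - x))"
proof (cases "x = 1")
  case True
  have "(\<lambda>n. 1 / real (Suc n)) \<longlonglongrightarrow> 0"
    by (rule lim_1_over_n[THEN LIMSEQ_Suc])
  then have "(\<lambda>n. 1 / real (Suc n) - 1 / real (Suc (Suc n))) sums (1 / real (Suc 0) - 0)"
    by (rule telescope_sums')
  then show ?thesis
    using True by (simp add: field_simps)
next
  case False
  then have "(\<lambda>n. x ^ n / real n) sums (- ln (1 - x))"
    using sums_minus[OF ln_series'[of "- x"]] assms by simp
  then have A: "(\<lambda>n. x ^ Suc n / real (Suc n)) sums (- ln (1 - x))"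
    by (subst sums_Suc_iff) simp
  then have B: "(\<lambda>n. x ^ Suc (Suc n) / real (Suc (Suc n))) sums (- ln (1 - x) - x)"
    by (subst sums_Suc_iff) simp
  have "(\<lambda>n. x * (x ^ Suc n / real (Suc n)) - x ^ Suc (Suc n) / real (Suc (Suc n)))
      sums (x * (- ln (1 - x)) - (- ln (1 - x) - x))"
    by (intro sums_diff sums_mult A B)
  moreover have "x * (x ^ Suc n / real (Suc n)) - x ^ Suc (Suc n) / real (Suc (Suc n))
      = x ^ Suc (Suc n) / (real (Suc n) * real (Suc (Suc n)))" for n
    by (simp add: divide_simps) (simp add: algebra_simps)
  ultimately show ?thesis
    by (simp add: algebra_simps)
qed

text \<open>
  Combine the preceding series at \<open>1\<close>, \<open>p\<close> and \<open>1 - p\<close>: the linear parts cancel.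
\<close>

lemma entropy_power_gap_sums:
  fixes p :: real
  assumes "0 \<le> p" "p \<le> 1"
  shows "(\<lambda>n. power_gap_tail (Suc n) p / real (Suc n)) sums (- (p * ln p) - (1 - p) * ln (1 - p))"
proof -
  have "(\<lambda>n. 1 ^ Suc (Suc n) / (real (Suc n) * real (Suc (Suc n)))
        - p ^ Suc (Suc n) / (real (Suc n) * real (Suc (Suc n)))
        - (1 - p) ^ Suc (Suc n) / (real (Suc n) * real (Suc (Suc n))))
      sums (1 + (1 - 1) * ln (1 - 1) - (p + (1 - p) * ln (1 - p))
        - ((1 - p) + (1 - (1 - p)) * ln (1 - (1 - p))))"
    by (intro sums_diff ln_power_sums) (use assms in auto)
  moreover have "1 ^ Suc (Suc n) / (real (Suc n) * real (Suc (Suc n)))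
        - p ^ Suc (Suc n) / (real (Suc n) * real (Suc (Suc n)))
        - (1 - p) ^ Suc (Suc n) / (real (Suc n) * real (Suc (Suc n)))
      = power_gap_tail (Suc n) p / real (Suc n)" for n
    unfolding power_gap_tail_def by (simp only: diff_divide_distrib divide_divide_eq_left mult.commute power_one)
  ultimately show ?thesis
    by simp
qed

section \<open>Two integration lemmas\<close>

text \<open>
  The quadratic form \<open>(s, t) \<mapsto> \<integral> (s f - t g)\<^sup>2\<close> is non-negative, so its discriminant has a sign.
\<close>

lemma integral_Cauchy_Schwarz:
  fixes f g :: "'a \<Rightarrow> real"
  assumes [measurable]: "f \<in> borel_measurable N" "g \<in> borel_measurable N"
    and f2: "integrable N (\<lambda>x. (f x)\<^sup>2)" and g2: "integrable N (\<lambda>x. (g x)\<^sup>2)"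
  shows "integrable N (\<lambda>x. f x * g x)"
    and "(\<integral>x. f x * g x \<partial>N) \<le> sqrt (\<integral>x. (f x)\<^sup>2 \<partial>N) * sqrt (\<integral>x. (g x)\<^sup>2 \<partial>N)"
proof -
  show fg: "integrable N (\<lambda>x. f x * g x)"
  proof (rule Bochner_Integration.integrable_bound[OF Bochner_Integration.integrable_add[OF f2 g2]])
    have "\<bar>a * b\<bar> \<le> a\<^sup>2 + b\<^sup>2" for a b :: real
      using sum_squares_bound[of "\<bar>a\<bar>" "\<bar>b\<bar>"] abs_ge_zero[of "a * b"]
      unfolding abs_mult power2_abs mult.assoc by linarith
    then show "AE x in N. norm (f x * g x) \<le> norm ((f x)\<^sup>2 + (g x)\<^sup>2)"
      by simp
  qed simp
  define a b c where "a = (\<integral>x. (f x)\<^sup>2 \<partial>N)" and "b = (\<integral>x. (g x)\<^sup>2 \<partial>N)" and "c = (\<integral>x. f x * g x \<partial>N)"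
  have quad: "0 \<le> s\<^sup>2 * a - 2 * s * t * c + t\<^sup>2 * b" for s t
  proof -
    have "0 \<le> (\<integral>x. (s * f x - t * g x)\<^sup>2 \<partial>N)"
      by simp
    also have "\<dots> = (\<integral>x. s\<^sup>2 * (f x)\<^sup>2 - 2 * s * t * (f x * g x) + t\<^sup>2 * (g x)\<^sup>2 \<partial>N)"
      by (simp add: power2_eq_square algebra_simps)
    also have "\<dots> = s\<^sup>2 * a - 2 * s * t * c + t\<^sup>2 * b"
      using f2 g2 fg by (simp add: a_def b_def c_def)
    finally show ?thesis .
  qed
  have nonneg: "0 \<le> a" "0 \<le> b"
    by (simp_all add: a_def b_def)
  have "c\<^sup>2 \<le> a * b"
  proof (cases "b = 0")
    case True
    have "c = 0"
    proof (rule ccontr)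
      assume "c \<noteq> 0"
      then show False
        \<comment> \<open>With \<open>b = 0\<close> the form is linear in \<open>t\<close>; at this \<open>t\<close> its value is \<open>- 1\<close>.\<close>
        using quad[of 1 "(a + 1) / (2 * c)"] True by simp
    qed
    then show ?thesis
      using nonneg by simp
  next
    case False
    have "0 \<le> b * (a * b - c\<^sup>2)"
      using quad[of b c] by (simp add: power2_eq_square algebra_simps)
    then show ?thesis
      using False nonneg by (simp add: zero_le_mult_iff)
  qed
  then have "c \<le> sqrt a * sqrt b"
    by (metis real_le_rsqrt real_sqrt_mult)
  then show "(\<integral>x. f x * g x \<partial>N) \<le> sqrt (\<integral>x. (f x)\<^sup>2 \<partial>N) * sqrt (\<integral>x. (g x)\<^sup>2 \<partial>N)"
    by (simp add: a_def b_def c_def)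
qed

text \<open>
  A non-negative \<open>Q u\<close> is the length of \<open>{0..<Q u}\<close>, so \<open>w u * Q u\<close> is the integral of
  \<open>w u\<close> over the \<open>x \<ge> 0\<close> with \<open>x < Q u\<close>; exchange the order of integration.
\<close>

lemma weighted_layer_cake:
  fixes w Q :: "'a \<Rightarrow> real"
  assumes "sigma_finite_measure N"
    and [measurable]: "w \<in> borel_measurable N" "Q \<in> borel_measurable N"
    and nonneg: "AE u in N. 0 \<le> Q u"
    and int: "integrable N (\<lambda>u. w u * Q u)"
  shows "set_integrable lborel {0..} (\<lambda>x. \<integral>u. w u * indicator {x<..} (Q u) \<partial>N)"
    and "(LBINT x:{0..}. \<integral>u. w u * indicator {x<..} (Q u) \<partial>N) = (\<integral>u. w u * Q u \<partial>N)"
proof -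
  interpret N: sigma_finite_measure N by fact
  interpret pair_sigma_finite N "lborel :: real measure" ..
  define f where "f u x = w u * indicator {(u, x). 0 \<le> x \<and> x < Q u} (u, x)" for u and x :: real
  have fiber: "f u x = w u * indicator {0..<Q u} x" for u x
    by (simp add: f_def indicator_def)
  have f_meas[measurable]: "case_prod f \<in> borel_measurable (N \<Otimes>\<^sub>M lborel)"
    unfolding f_def by measurable
  have "integrable (N \<Otimes>\<^sub>M lborel) (case_prod f)"
  proof (rule Fubini_integrable)
    have "integrable N (\<lambda>u. \<bar>w u * Q u\<bar>)"
      using int by simp
    moreover have "AE u in N. \<bar>w u * Q u\<bar> = (\<integral>x. norm (case_prod f (u, x)) \<partial>lborel)"
      using nonneg by eventually_elim (simp add: fiber abs_mult)
    ultimately show "integrable N (\<lambda>u. \<integral>x. norm (case_prod f (u, x)) \<partial>lborel)"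
      by (subst integrable_cong_AE[where g = "\<lambda>u. \<bar>w u * Q u\<bar>"]) auto
    have "integrable lborel (indicator {0..<Q u} :: real \<Rightarrow> real)" for u
      by (cases "0 \<le> Q u") (auto intro!: integrable_real_indicator)
    then show "AE u in N. integrable lborel (\<lambda>x. case_prod f (u, x))"
      by (simp add: fiber)
  qed simp
  note swap = integrable_snd[OF this] Fubini_integral[OF this]
  have slice: "(\<integral>u. f u x \<partial>N) = indicator {0..} x * (\<integral>u. w u * indicator {x<..} (Q u) \<partial>N)" for x
    by (cases "0 \<le> x") (simp_all add: f_def indicator_def)
  show "set_integrable lborel {0..} (\<lambda>x. \<integral>u. w u * indicator {x<..} (Q u) \<partial>N)"
    using swap(1) by (simp add: set_integrable_def slice)
  have "(\<integral>u. (\<integral>x. f u x \<partial>lborel) \<partial>N) = (\<integral>u. w u * Q u \<partial>N)"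
  proof (rule integral_cong_AE)
    show "AE u in N. (\<integral>x. f u x \<partial>lborel) = w u * Q u"
      using nonneg by eventually_elim (simp add: fiber)
  qed measurable
  then show "(LBINT x:{0..}. \<integral>u. w u * indicator {x<..} (Q u) \<partial>N) = (\<integral>u. w u * Q u \<partial>N)"
    using swap(2) by (simp add: set_lebesgue_integral_def slice)
qed

section \<open>Bounding a single term\<close>

lemma quantile_coupling:
  assumes "real_distribution \<nu>"
  obtains Q :: "real \<Rightarrow> real" where "Q \<in> borel_measurable unit_uniform"
    and "distr unit_uniform borel Q = \<nu>"
    and "\<And>u x. 0 < u \<Longrightarrow> u < 1 \<Longrightarrow> x < Q u \<longleftrightarrow> cdf \<nu> x < u"
proof -
  interpret cdf_distribution \<nu>
    unfolding cdf_distribution_def by fact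
  have "I \<in> borel_measurable unit_uniform"
    using measurable_CI by (simp add: measurable_def space_restrict_space sets_restrict_space)
  moreover have "x < I u \<longleftrightarrow> cdf \<nu> x < u" if "0 < u" "u < 1" for u x
    using pseudoinverse[OF that] by (meson not_le)
  ultimately show thesis
    using that distr_I_eq_M by blast
qed

text \<open>
  Realise \<open>X\<close> as its quantile function \<open>Q\<close> on the unit interval.  The integrand at \<open>x\<close> is then the
  integral of the power gap over \<open>{u. x < Q u}\<close>, so its integral over \<open>x \<ge> 0\<close> is that of the power gap
  times \<open>Q\<close>, which is a covariance because the power gap has mean zero.
\<close>

lemma power_gap_tail_cdf_integral:
  fixes M :: "'a measure" and X :: "'a \<Rightarrow> real" and \<sigma> :: real
  assumes M: "prob_space M" and X[measurable]: "X \<in> borel_measurable M"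
    and nonneg: "AE \<omega> in M. 0 \<le> X \<omega>" and int: "integrable M X"
    and int2: "integrable M (\<lambda>\<omega>. (X \<omega>)\<^sup>2)"
    and var: "prob_space.variance M X = \<sigma>\<^sup>2" and \<sigma>: "0 \<le> \<sigma>"
  shows "set_integrable lborel {0..} (\<lambda>x. power_gap_tail n (cdf (distr M borel X) x))"
    and "(LBINT x:{0..}. power_gap_tail n (cdf (distr M borel X) x))
          \<le> sqrt 2 * \<sigma> * sqrt (1 / (2 * real n + 1) - Beta (real n + 1) (real n + 1))"
proof -
  interpret prob_space M by (rule M)
  interpret U: prob_space unit_uniform by (rule prob_space_unit_uniform)
  define F where "F = cdf (distr M borel X)"
  interpret D: real_distribution "distr M borel X" by simp
  obtain Q where Q[measurable]: "Q \<in> borel_measurable unit_uniform"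
    and distr: "distr unit_uniform borel Q = distr M borel X"
    and quantile: "\<And>u x. 0 < u \<Longrightarrow> u < 1 \<Longrightarrow> x < Q u \<longleftrightarrow> F x < u"
    using quantile_coupling[OF D.real_distribution_axioms, folded F_def] by blast
  have transfer_int: "integrable unit_uniform (\<lambda>u. h (Q u)) \<longleftrightarrow> integrable M (\<lambda>\<omega>. h (X \<omega>))"
    and transfer: "(\<integral>u. h (Q u) \<partial>unit_uniform) = expectation (\<lambda>\<omega>. h (X \<omega>))"
    if [measurable]: "h \<in> borel_measurable borel" for h :: "real \<Rightarrow> real"
    using integrable_distr_eq[OF Q that] integrable_distr_eq[OF X that]
      integral_distr[OF Q that] integral_distr[OF X that] distr by simp_all
  have Q_nonneg: "AE u in unit_uniform. 0 \<le> Q u"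
  proof -
    have "AE y in distr M borel X. 0 \<le> y"
      using nonneg by (subst AE_distr_iff) auto
    then have "AE y in distr unit_uniform borel Q. 0 \<le> y"
      by (simp only: distr)
    then show ?thesis
      by (subst (asm) AE_distr_iff) auto
  qed
  let ?w = "power_gap n" and ?m = "expectation X"
  have w[measurable]: "?w \<in> borel_measurable unit_uniform"
    by (rule measurable_restrict_space1) (simp add: power_gap_def[abs_def])
  have centred: "integrable unit_uniform (\<lambda>u. (Q u - ?m)\<^sup>2)"
    "(\<integral>u. (Q u - ?m)\<^sup>2 \<partial>unit_uniform) = \<sigma>\<^sup>2"
    using transfer_int[of "\<lambda>y. (y - ?m)\<^sup>2"] transfer[of "\<lambda>y. (y - ?m)\<^sup>2"] var int int2
    by (simp_all add: power2_diff)
  note CS = integral_Cauchy_Schwarz[OF w _ power_gap_square_integral(1) centred(1)]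
  have w_int: "integrable unit_uniform ?w" and w_zero: "integral\<^sup>L unit_uniform ?w = 0"
  proof -
    show "integrable unit_uniform ?w"
      by (rule unit_uniform_integral(1))
        (auto simp: power_gap_def intro!: continuous_intros integrable_integral integrable_continuous_real)
    have "integral\<^sup>L unit_uniform ?w = (\<integral>u. ?w u * indicator {0<..} u \<partial>unit_uniform)"
      by (rule Bochner_Integration.integral_cong) (auto simp: space_restrict_space)
    then show "integral\<^sup>L unit_uniform ?w = 0"
      by (simp add: power_gap_integral_above power_gap_tail_def)
  qed
  have wQ: "?w u * Q u = ?w u * (Q u - ?m) + ?m * ?w u" for u
    by (simp add: algebra_simps)
  have wQ_int: "integrable unit_uniform (\<lambda>u. ?w u * Q u)"
    unfolding wQ using CS(1) w_int by simp
  have tail: "(\<integral>u. ?w u * indicator {x<..} (Q u) \<partial>unit_uniform) = power_gap_tail n (F x)" for x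
  proof -
    have "(\<integral>u. ?w u * indicator {x<..} (Q u) \<partial>unit_uniform)
        = (\<integral>u. ?w u * indicator {F x<..} u \<partial>unit_uniform)"
      by (rule Bochner_Integration.integral_cong)
        (auto simp: space_restrict_space quantile indicator_def)
    then show ?thesis
      by (simp add: F_def D.cdf_nonneg D.cdf_bounded_prob power_gap_integral_above)
  qed
  note cake = weighted_layer_cake[OF U.sigma_finite_measure_axioms w Q Q_nonneg wQ_int, unfolded tail]
  show "set_integrable lborel {0..} (\<lambda>x. power_gap_tail n (cdf (distr M borel X) x))"
    using cake(1) by (simp add: F_def)
  have "(LBINT x:{0..}. power_gap_tail n (F x)) = (\<integral>u. ?w u * (Q u - ?m) \<partial>unit_uniform)"
    unfolding cake(2) wQ using CS(1) w_int w_zero by simp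
  also have "\<dots> \<le> sqrt (2 * (1 / (2 * real n + 1) - Beta (real n + 1) (real n + 1))) * sqrt (\<sigma>\<^sup>2)"
    using CS(2) by (simp add: power_gap_square_integral(2) centred(2))
  also have "\<dots> = sqrt 2 * \<sigma> * sqrt (1 / (2 * real n + 1) - Beta (real n + 1) (real n + 1))"
    unfolding real_sqrt_mult using \<sigma> by simp
  finally show "(LBINT x:{0..}. power_gap_tail n (cdf (distr M borel X) x))
      \<le> sqrt 2 * \<sigma> * sqrt (1 / (2 * real n + 1) - Beta (real n + 1) (real n + 1))"
    by (simp add: F_def)
qed

section \<open>Summing the bounds\<close>

text \<open>
  The radicand is half of a squared \<open>L\<^sup>2\<close> norm, and a real square root is negative at negative arguments.
\<close>

lemma entropy_bound_term_nonneg: "0 \<le> entropy_bound_term n"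
proof -
  have "0 \<le> (\<integral>u. (power_gap n u)\<^sup>2 \<partial>unit_uniform)"
    by simp
  then show ?thesis
    by (simp add: power_gap_square_integral(2) entropy_bound_term_def)
qed

lemma summable_entropy_bound_term: "summable (\<lambda>n. entropy_bound_term (Suc n))"
proof (rule summable_comparison_test)
  show "summable (\<lambda>n. real (Suc n) powr (- 3 / 2))"
    using summable_real_powr_iff[of "- 3 / 2"] by (subst summable_Suc_iff) simp
  have "entropy_bound_term (Suc n) \<le> real (Suc n) powr (- 3 / 2)" for n
  proof -
    let ?m = "real (Suc n)"
    have "0 \<le> Beta (?m + 1) (?m + 1)"
      unfolding Beta_def by (intro divide_nonneg_nonneg mult_nonneg_nonneg Gamma_real_nonneg) auto
    moreover have "1 / (2 * ?m + 1) \<le> 1 / ?m"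
      by (rule divide_left_mono) auto
    ultimately have "sqrt (1 / (2 * ?m + 1) - Beta (?m + 1) (?m + 1)) \<le> sqrt (1 / ?m)"
      by (intro real_sqrt_le_mono) linarith
    then have "entropy_bound_term (Suc n) \<le> 1 / ?m * sqrt (1 / ?m)"
      unfolding entropy_bound_term_def by (intro mult_left_mono) auto
    also have "\<dots> = ?m powr (- 1) * ?m powr (- 1 / 2)"
    proof -
      have "sqrt (1 / ?m) = 1 / ?m powr (1 / 2)"
        by (simp only: real_sqrt_divide real_sqrt_one powr_half_sqrt of_nat_0_le_iff)
      also have "\<dots> = ?m powr (- 1 / 2)"
        using powr_minus_divide[of ?m "1 / 2"] by (simp only: minus_divide_left)
      finally show ?thesis
        using powr_minus_divide[of ?m 1] by (simp only: powr_one of_nat_0_le_iff)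
    qed
    also have "\<dots> = ?m powr (- 1 + - 1 / 2)"
      by (rule powr_add[symmetric])
    also have "- 1 + - 1 / 2 = (- 3 / 2 :: real)"
      by simp
    finally show ?thesis .
  qed
  then show "\<exists>N. \<forall>n\<ge>N. norm (entropy_bound_term (Suc n)) \<le> real (Suc n) powr (- 3 / 2)"
    by (simp add: entropy_bound_term_nonneg)
qed

theorem theorem6:
  fixes M :: "'a measure" and X :: "'a \<Rightarrow> real" and \<mu> \<sigma> :: real
  assumes "prob_space M"
    and "X \<in> borel_measurable M"
    and "AE \<omega> in M. 0 \<le> X \<omega>"
    and "absolutely_continuous lborel (distr M borel X)"
    and "integrable M X"
    and "prob_space.expectation M X = \<mu>"
    and "integrable M (\<lambda>\<omega>. (X \<omega>)\<^sup>2)"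
    and "prob_space.variance M X = \<sigma>\<^sup>2"
    and "\<sigma> > 0"
    and "symmetric_about M X \<mu>"
  shows "finite_cumulative_residual_entropy M X
    \<and> finite_cumulative_entropy M X
    \<and> summable (\<lambda>n. entropy_bound_term (Suc n))
    \<and> cumulative_residual_entropy M X + cumulative_entropy M X
        \<le> sqrt 2 * \<sigma> * (\<Sum>n. entropy_bound_term (Suc n))"
proof -
  interpret prob_space M by fact
  interpret D: real_distribution "distr M borel X"
    using assms(2) by simp
  define F where "F = cdf (distr M borel X)"
  have F01: "0 \<le> F x" "F x \<le> 1" for x
    by (simp_all add: F_def D.cdf_nonneg D.cdf_bounded_prob)
  have F_meas[measurable]: "F \<in> borel_measurable borel"
    unfolding F_def by (intro borel_measurable_mono monoI D.cdf_nondecreasing)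
  define g where "g n x = indicator {0..} x * (power_gap_tail (Suc n) (F x) / real (Suc n))" for n x
  define H where "H x = indicator {0..} x * (- (F x * ln (F x)) - (1 - F x) * ln (1 - F x))" for x
  have g_nonneg: "0 \<le> g n x" for n x
    unfolding g_def by (intro mult_nonneg_nonneg divide_nonneg_nonneg power_gap_tail_nonneg F01) auto
  have g_sums: "(\<lambda>n. g n x) sums H x" for x
    unfolding g_def H_def by (intro sums_mult entropy_power_gap_sums F01)
  note tails = power_gap_tail_cdf_integral[OF assms(1-3,5,7,8) less_imp_le[OF assms(9)], folded F_def]
  have g_int: "integrable lborel (g n)" for n
    using integrable_divide[OF tails(1)[of "Suc n", unfolded set_integrable_def], of "real (Suc n)"]
    by (simp add: g_def[abs_def])
  have g_le: "integral\<^sup>L lborel (g n) \<le> sqrt 2 * \<sigma> * entropy_bound_term (Suc n)" for n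
  proof -
    have "integral\<^sup>L lborel (g n) = (LBINT x:{0..}. power_gap_tail (Suc n) (F x)) / real (Suc n)"
      by (simp add: g_def[abs_def] set_lebesgue_integral_def flip: integral_divide_zero del: of_nat_Suc)
    also have "\<dots> \<le> (sqrt 2 * \<sigma> * sqrt (1 / (2 * real (Suc n) + 1) - Beta (real (Suc n) + 1) (real (Suc n) + 1)))
        / real (Suc n)"
      by (intro divide_right_mono tails(2)) simp
    finally show ?thesis
      by (simp add: entropy_bound_term_def)
  qed
  have bound_summable: "summable (\<lambda>n. sqrt 2 * \<sigma> * entropy_bound_term (Suc n))"
    by (intro summable_mult summable_entropy_bound_term)
  have norm_sums: "AE x in lborel. summable (\<lambda>n. norm (g n x))"
    using g_sums by (auto simp: g_nonneg sums_iff)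
  have int_sums: "summable (\<lambda>n. \<integral>x. norm (g n x) \<partial>lborel)"
    by (rule summable_comparison_test[OF _ bound_summable]) (simp add: g_nonneg g_le)
  have H_eq: "(\<lambda>x. \<Sum>n. g n x) = H"
    using g_sums by (auto simp: sums_iff)
  have H_int: "integrable lborel H"
    using integrable_suminf[OF g_int norm_sums int_sums] by (simp add: H_eq)
  have "(\<lambda>n. integral\<^sup>L lborel (g n)) sums integral\<^sup>L lborel H"
    using sums_integral[OF g_int norm_sums int_sums] by (simp add: H_eq)
  then have H_le: "integral\<^sup>L lborel H \<le> sqrt 2 * \<sigma> * (\<Sum>n. entropy_bound_term (Suc n))"
    using sums_le[OF g_le _ summable_sums[OF bound_summable]]
    by (simp add: suminf_mult summable_entropy_bound_term)
  have neg: "p * ln p \<le> 0" if "0 \<le> p" "p \<le> 1" for p :: real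
    using that by (cases "p = 0") (simp_all add: mult_nonneg_nonpos)
  have negs: "F x * ln (F x) \<le> 0" "(1 - F x) * ln (1 - F x) \<le> 0" for x
    using F01[of x] by (auto intro!: neg)
  have "norm (indicator {0..} x * ((1 - F x) * ln (1 - F x))) \<le> norm (H x)"
    and "norm (indicator {0..} x * (F x * ln (F x))) \<le> norm (H x)" for x
    using negs[of x] by (auto simp: H_def indicator_def)
  note dominated = this[THEN AE_I2]
  have res: "integrable lborel (\<lambda>x. indicator {0..} x * ((1 - F x) * ln (1 - F x)))"
    by (rule Bochner_Integration.integrable_bound[OF H_int _ dominated(1)]) simp
  have cum: "integrable lborel (\<lambda>x. indicator {0..} x * (F x * ln (F x)))"
    by (rule Bochner_Integration.integrable_bound[OF H_int _ dominated(2)]) simp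
  have "cumulative_residual_entropy M X + cumulative_entropy M X
      = - ((\<integral>x. indicator {0..} x * ((1 - F x) * ln (1 - F x)) \<partial>lborel)
         + (\<integral>x. indicator {0..} x * (F x * ln (F x)) \<partial>lborel))"
    by (simp add: cumulative_residual_entropy_def cumulative_entropy_def set_lebesgue_integral_def F_def)
  also have "\<dots> = integral\<^sup>L lborel H"
    unfolding Bochner_Integration.integral_add[OF res cum, symmetric] integral_minus[symmetric]
    by (simp add: H_def[abs_def] algebra_simps)
  finally show ?thesis
    using H_le res cum summable_entropy_bound_term
    by (simp add: finite_cumulative_residual_entropy_def finite_cumulative_entropy_def
        set_integrable_def F_def)
qed

end
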